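(* Let $\phi$ be a Boolean formula in variables $y_1,\dots,y_m$ such that the Hamming distance between any two distinct models of $\phi$ is at least $d\ge1$, let $s\ge1$ be an integer, $\beta>0$, $\lambda\in(0,\tfrac12]$, and suppose $\#\phi>2^{s+\beta}$. Let $c_1,\dots,c_s$ be XOR constraints drawn independently from the distribution below, $\chi_s=\phi\wedge c_1\wedge\cdots\wedge c_s$, $T_s=\#\chi_s$ and $\mu_s=E[T_s]$. Then $\dfrac{\mathrm{var}(T_s)}{\mu_s^2}\le B(s,m,\beta,d,\lambda)$.
   Context: $\#\psi$ is the number of models of $\psi$. An XOR constraint on $y_1,\dots,y_m$ is an equation $a_0=a_1y_1\oplus\cdots\oplus a_my_m$; constraints are drawn with $a_0$ uniform in $\{0,1\}$ and each $a_i$ ($i\ge1$) equal to $1$ independently with probability $\lambda$. Let $\rho=1-2\lambda$ and $N=\lceil 2^{s+\beta}\rceil$. For $j=d,\dots,m$: $l_j=j-\lceil d/2\rceil+1$ if $j\le m/2$, and $l_j=\max\{0,m-j-\lceil d/2\rceil+1\}$ if $j>m/2$; $w^*=\min\{w:d\le w\le m,\ \sum_{j=d}^w\binom{m}{l_j}\ge N-1\}$ (with $\min\emptyset=0$); $N^*=\sum_{j=d}^{w^*-1}\binom{m}{l_j}$. Then $$B(s,m,\beta,d,\lambda)=2^{-\beta}+2^{-s-\beta}\left(\sum_{j=d}^{w^*-1}\binom{m}{l_j}(1+\rho^j)^s+(N-1-N^* )(1+\rho^{w^*})^s\right)-1.$$ *)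

theory Defs
  imports "HOL-Probability.Probability"
begin

datatype (vars: 'v) formula =
    Const bool
  | Var 'v
  | Neg "'v formula"
  | Conj "'v formula" "'v formula"
  | Disj "'v formula" "'v formula"
  | Impl "'v formula" "'v formula"
  | Iff "'v formula" "'v formula"
  | Xor "'v formula" "'v formula"

primrec holds :: "('v \<Rightarrow> bool) \<Rightarrow> 'v formula \<Rightarrow> bool" where
  "holds v (Const b) = b"
| "holds v (Var x) = v x"
| "holds v (Neg p) = (\<not> holds v p)"
| "holds v (Conj p q) = (holds v p \<and> holds v q)"
| "holds v (Disj p q) = (holds v p \<or> holds v q)"
| "holds v (Impl p q) = (holds v p \<longrightarrow> holds v q)"
| "holds v (Iff p q) = (holds v p \<longleftrightarrow> holds v q)"
| "holds v (Xor p q) = (holds v p \<noteq> holds v q)"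

text \<open>The variables are \<open>1, \<dots>, m\<close>. Assignments are extensional functions on this index set,
  so that there are exactly \<open>2 ^ m\<close> of them.\<close>

definition models :: "nat \<Rightarrow> nat formula \<Rightarrow> (nat \<Rightarrow> bool) set" where
  "models m p = {v \<in> {1..m} \<rightarrow>\<^sub>E UNIV. holds v p}"

definition num_models :: "nat \<Rightarrow> nat formula \<Rightarrow> nat" where
  "num_models m p = card (models m p)"

definition hamming_dist :: "nat \<Rightarrow> (nat \<Rightarrow> bool) \<Rightarrow> (nat \<Rightarrow> bool) \<Rightarrow> nat" where
  "hamming_dist m u v = card {i \<in> {1..m}. u i \<noteq> v i}"

text \<open>The coefficients \<open>a 0, \<dots>, a m\<close> encode the constraint
  \<open>a 0 = a 1 y\<^sub>1 \<oplus> \<dots> \<oplus> a m y\<^sub>m\<close>.\<close>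

definition xor_constraint :: "nat \<Rightarrow> (nat \<Rightarrow> bool) \<Rightarrow> nat formula" where
  "xor_constraint m a =
     Iff (Const (a 0)) (foldr Xor (map (\<lambda>i. Conj (Const (a i)) (Var i)) [1..<Suc m]) (Const False))"

definition xor_coeffs_pmf :: "nat \<Rightarrow> real \<Rightarrow> (nat \<Rightarrow> bool) pmf" where
  "xor_coeffs_pmf m lam =
     Pi_pmf {0..m} False (\<lambda>i. if i = 0 then bernoulli_pmf (1 / 2) else bernoulli_pmf lam)"

definition constraints_pmf :: "nat \<Rightarrow> nat \<Rightarrow> real \<Rightarrow> (nat \<Rightarrow> nat formula) pmf" where
  "constraints_pmf s m lam =
     Pi_pmf {1..s} (Const True) (\<lambda>_. map_pmf (xor_constraint m) (xor_coeffs_pmf m lam))"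

definition conj_constraints :: "nat \<Rightarrow> nat formula \<Rightarrow> (nat \<Rightarrow> nat formula) \<Rightarrow> nat formula" where
  "conj_constraints s p c = foldl Conj p (map c [1..<Suc s])"

definition l_idx :: "nat \<Rightarrow> nat \<Rightarrow> nat \<Rightarrow> nat" where
  "l_idx m d j = nat (if real j \<le> real m / 2
     then int j - \<lceil>real d / 2\<rceil> + 1
     else max 0 (int m - int j - \<lceil>real d / 2\<rceil> + 1))"

definition N_bound :: "nat \<Rightarrow> real \<Rightarrow> int" where
  "N_bound s \<beta> = \<lceil>2 powr (real s + \<beta>)\<rceil>"

definition w_star :: "nat \<Rightarrow> nat \<Rightarrow> real \<Rightarrow> nat \<Rightarrow> nat" where
  "w_star s m \<beta> d =
     (let W = {w. d \<le> w \<and> w \<le> m \<and> int (\<Sum>j=d..w. m choose l_idx m d j) \<ge> N_bound s \<beta> - 1}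
      in if W = {} then 0 else Min W)"

definition N_star :: "nat \<Rightarrow> nat \<Rightarrow> real \<Rightarrow> nat \<Rightarrow> nat" where
  "N_star s m \<beta> d = (\<Sum>j=d..<w_star s m \<beta> d. m choose l_idx m d j)"

definition B :: "nat \<Rightarrow> nat \<Rightarrow> real \<Rightarrow> nat \<Rightarrow> real \<Rightarrow> real" where
  "B s m \<beta> d lam =
     (let \<rho> = 1 - 2 * lam; w = w_star s m \<beta> d in
      2 powr (- \<beta>) + 2 powr (- real s - \<beta>) *
        ((\<Sum>j=d..<w. real (m choose l_idx m d j) * (1 + \<rho> ^ j) ^ s)
         + (of_int (N_bound s \<beta>) - 1 - real (N_star s m \<beta> d)) * (1 + \<rho> ^ w) ^ s) - 1)"

end

theory Submission
  imports Defs
begin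

text \<open>
  Writing truth values as signs, the indicator of an XOR constraint at an assignment becomes a
  product of independent factors, so two assignments at Hamming distance \<open>j\<close> satisfy a random
  constraint simultaneously with probability \<open>(1 + \<rho> ^ j) / 4\<close>. Hence \<open>var T / \<mu>\<^sup>2 + 1\<close> is
  the average of \<open>(1 + \<rho> ^ dist u v) ^ s\<close> over all pairs of models, the diagonal included.
  For fixed \<open>u\<close>, the models at distance \<open>j\<close> from \<open>u\<close> form a constant weight code, and any two
  members sharing an \<open>l\<^sub>j\<close>-subset of their supports (of the complements of their supports if
  \<open>j > m / 2\<close>) coincide; so there are at most \<open>m choose l\<^sub>j\<close> of them. As the summand decreases in
  \<open>j\<close>, filling the distance classes greedily bounds the sum, and since the average of an initial
  segment of a decreasing sequence decreases with its length, the number of models may be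
  replaced by \<open>N\<close>.
\<close>

subsection \<open>Constant weight codes\<close>

text \<open>Give each member a subset of size \<open>j + 1 - k\<close>. Two members sharing it would
  differ in fewer than \<open>k\<close> elements, so the choice is injective.\<close>

lemma card_uniform_family_le_choose:
  fixes F :: "'a set set"
  assumes "finite X" and sub: "\<And>A. A \<in> F \<Longrightarrow> A \<subseteq> X"
    and card: "\<And>A. A \<in> F \<Longrightarrow> card A = j" and "k \<ge> 1"
    and sep: "\<And>A B. A \<in> F \<Longrightarrow> B \<in> F \<Longrightarrow> A \<noteq> B \<Longrightarrow> card (A - B) \<ge> k"
  shows "card F \<le> card X choose (j + 1 - k)"
proof -
  have "\<exists>G. G \<subseteq> A \<and> card G = j + 1 - k" if "A \<in> F" for A
    by (rule obtain_subset_with_card_n[of "j + 1 - k" A]) (use card[OF that] \<open>k \<ge> 1\<close> in auto)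
  then obtain g where g: "\<And>A. A \<in> F \<Longrightarrow> g A \<subseteq> A \<and> card (g A) = j + 1 - k"
    by metis
  have "inj_on g F"
  proof (rule inj_onI, rule ccontr)
    fix A B assume AB: "A \<in> F" "B \<in> F" "g A = g B" "A \<noteq> B"
    have fin: "finite A"
      using sub[OF AB(1)] \<open>finite X\<close> finite_subset by blast
    have "A - B \<subseteq> A - g A"
      using g[OF AB(2)] AB(3) by blast
    then have "card (A - B) \<le> card (A - g A)"
      using fin by (simp add: card_mono)
    also have "\<dots> = j - (j + 1 - k)"
      using g[OF AB(1)] card[OF AB(1)] fin by (metis card_Diff_subset finite_subset)
    \<comment> \<open>Truncation is harmless here: \<open>k \<le> card (A - B) \<le> j\<close>, so
      the difference equals \<open>k - 1\<close>.\<close>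
    also have "\<dots> < k"
      using \<open>k \<ge> 1\<close> fin card[OF AB(1)] sep[OF AB(1,2,4)] card_mono[OF fin, of "A - B"] by simp
    finally show False
      using sep[OF AB(1,2,4)] by simp
  qed
  moreover have "g ` F \<subseteq> {K. K \<subseteq> X \<and> card K = j + 1 - k}"
    using g sub by blast
  ultimately show ?thesis
    using card_inj_on_le[of g F "{K. K \<subseteq> X \<and> card K = j + 1 - k}"] \<open>finite X\<close>
    by (simp add: n_subsets)
qed

lemma ceiling_half_nat: "\<lceil>real d / 2\<rceil> = int ((d + 1) div 2)"
proof (cases "even d")
  case True
  then show ?thesis by (auto elim!: evenE)
next
  case False
  then obtain k where "d = 2 * k + 1" by (auto elim: oddE)
  then show ?thesis by (intro ceiling_unique) auto
qed

text \<open>Natural subtraction absorbs both \<open>nat\<close> and \<open>max 0\<close>. The index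
  thus gets the shape \<open>j + 1 - k\<close> of \<open>card_uniform_family_le_choose\<close>, with
  \<open>k\<close> half of \<open>d\<close> rounded up and with \<open>m - j\<close> for
  \<open>j\<close> in the upper half.\<close>

lemma l_idx_eq:
  assumes "j \<le> m"
  shows "l_idx m d j = (if real j \<le> real m / 2 then j else m - j) + 1 - (d + 1) div 2"
  using assms unfolding l_idx_def ceiling_half_nat by (auto simp: nat_diff_distrib' of_nat_diff)

lemma card_at_distance_le:
  assumes M: "M \<subseteq> {1..m} \<rightarrow>\<^sub>E (UNIV :: bool set)" and "d \<ge> 1" and "j \<le> m"
    and sep: "\<And>v w. v \<in> M \<Longrightarrow> w \<in> M \<Longrightarrow> v \<noteq> w \<Longrightarrow> hamming_dist m v w \<ge> d"
  shows "card {v \<in> M. hamming_dist m u v = j} \<le> m choose l_idx m d j"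
proof -
  define S where "S = {v \<in> M. hamming_dist m u v = j}"
  define D where "D v = {i \<in> {1..m}. u i \<noteq> v i}" for v
  have D: "D v \<subseteq> {1..m}" "finite (D v)" for v
    by (auto simp: D_def)
  have cD: "card (D v) = j" if "v \<in> S" for v
    using that by (auto simp: S_def D_def hamming_dist_def)
  have sepD: "card (D v - D w) \<ge> (d + 1) div 2" if vw: "v \<in> S" "w \<in> S" "v \<noteq> w" for v w
  proof -
    have "{i \<in> {1..m}. v i \<noteq> w i} = (D v - D w) \<union> (D w - D v)"
      by (auto simp: D_def)
    then have "hamming_dist m v w = card ((D v - D w) \<union> (D w - D v))"
      by (simp add: hamming_dist_def)
    also have "\<dots> = card (D v - D w) + card (D w - D v)"
      by (rule card_Un_disjoint) (use D in auto)
    \<comment> \<open>Equal cardinalities make the two halves of the symmetric difference equally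
      large, so each has at least half of \<open>d\<close> elements, rounded up.\<close>
    also have "card (D w - D v) = card (D v - D w)"
      using cD[OF vw(1)] cD[OF vw(2)] D(2) by (simp add: card_Diff_subset_Int Int_commute)
    finally show ?thesis
      using sep[of v w] vw by (auto simp: S_def)
  qed
  have inj: "inj_on D S"
    by (rule inj_onI, rule ccontr) (use sepD \<open>d \<ge> 1\<close> in fastforce)
  have k: "(d + 1) div 2 \<ge> 1"
    using \<open>d \<ge> 1\<close> by simp
  show ?thesis
  proof (cases "real j \<le> real m / 2")
    case True
    have "card (D ` S) \<le> card {1..m} choose (j + 1 - (d + 1) div 2)"
    proof (rule card_uniform_family_le_choose)
      fix A B assume "A \<in> D ` S" "B \<in> D ` S" "A \<noteq> B"
      then show "card (A - B) \<ge> (d + 1) div 2"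
        using sepD by blast
    qed (use D cD k in auto)
    then show ?thesis
      using True card_image[OF inj] l_idx_eq[OF \<open>j \<le> m\<close>] by (simp add: S_def)
  next
    case False
    \<comment> \<open>Complementation swaps the two differences, which keeps the separation, and
      lowers the weight from \<open>j\<close> to \<open>m - j\<close>.\<close>
    define E where "E v = {1..m} - D v" for v
    have cE: "card (E v) = m - j" if "v \<in> S" for v
      using cD[OF that] D by (simp add: E_def card_Diff_subset)
    have ED: "E v - E w = D w - D v" for v w
      using D(1)[of v] D(1)[of w] by (auto simp: E_def)
    have injE: "inj_on E S"
      using inj D(1) unfolding E_def inj_on_def by (metis double_diff order_refl)
    have "card (E ` S) \<le> card {1..m} choose (m - j + 1 - (d + 1) div 2)"
    proof (rule card_uniform_family_le_choose)
      fix A B assume "A \<in> E ` S" "B \<in> E ` S" "A \<noteq> B"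
      then show "card (A - B) \<ge> (d + 1) div 2"
        using sepD ED by (metis image_iff)
    qed (use cE k in \<open>auto simp: E_def\<close>)
    then show ?thesis
      using False card_image[OF injE] l_idx_eq[OF \<open>j \<le> m\<close>] by (simp add: S_def)
  qed
qed

subsection \<open>Moments of the number of models\<close>

text \<open>Turns exclusive or into multiplication, so that independent coefficients contribute
  independent factors.\<close>

definition sign :: "bool \<Rightarrow> real" where
  "sign b = (if b then - 1 else 1)"

lemma holds_foldr_Xor:
  "sign (holds v (foldr Xor ps (Const False))) = (\<Prod>p\<leftarrow>ps. sign (holds v p))"
  by (induction ps) (auto simp: sign_def)

text \<open>The constraint holds exactly when the signs of its two sides multiply to
  \<open>1\<close>. Index \<open>0\<close> joins the product as a variable that is always
  true.\<close>

lemma of_bool_holds_xor_constraint: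
  "of_bool (holds v (xor_constraint m a)) =
     (1 + (\<Prod>i\<in>{0..m}. sign (a i \<and> (i = 0 \<or> v i)))) / 2"
proof -
  have "sign (holds v (foldr Xor (map (\<lambda>i. Conj (Const (a i)) (Var i)) [1..<Suc m]) (Const False)))
      = (\<Prod>i\<leftarrow>[1..<Suc m]. sign (a i \<and> v i))"
    unfolding holds_foldr_Xor by (simp add: o_def)
  also have "\<dots> = (\<Prod>i\<in>{1..m}. sign (a i \<and> (i = 0 \<or> v i)))"
    by (subst prod.distinct_set_conv_list[symmetric]) (auto intro!: prod.cong)
  finally have *: "sign (holds v (foldr Xor (map (\<lambda>i. Conj (Const (a i)) (Var i)) [1..<Suc m])
      (Const False))) = (\<Prod>i\<in>{1..m}. sign (a i \<and> (i = 0 \<or> v i)))" .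
  have "(\<Prod>i\<in>{0..m}. sign (a i \<and> (i = 0 \<or> v i)))
      = sign (a 0) * (\<Prod>i\<in>{1..m}. sign (a i \<and> (i = 0 \<or> v i)))"
    by (simp add: prod.atLeast_Suc_atMost)
  then show ?thesis
    unfolding *[symmetric] xor_constraint_def by (auto simp: sign_def)
qed

text \<open>Independence factors the expectation; finite supports supply integrability for factors
  of either sign.\<close>

lemma expectation_prod_Pi_pmf_finite_support:
  fixes f :: "'a \<Rightarrow> 'b \<Rightarrow> real"
  assumes "finite A" and fin: "\<And>x. x \<in> A \<Longrightarrow> finite (set_pmf (p x))"
  shows "measure_pmf.expectation (Pi_pmf A dflt p) (\<lambda>y. \<Prod>x\<in>A. f x (y x)) =
    (\<Prod>x\<in>A. measure_pmf.expectation (p x) (f x))"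
proof -
  have comp: "map_pmf (\<lambda>y. y x) (Pi_pmf A dflt p) = p x" if "x \<in> A" for x
    using that \<open>finite A\<close> by (simp add: Pi_pmf_component)
  have "measure_pmf.expectation (Pi_pmf A dflt p) (\<lambda>y. \<Prod>x\<in>A. f x (y x)) =
      (\<Prod>x\<in>A. measure_pmf.expectation (Pi_pmf A dflt p) (\<lambda>y. f x (y x)))"
  proof (rule prob_space.indep_vars_lebesgue_integral)
    show "prob_space.indep_vars (measure_pmf (Pi_pmf A dflt p)) (\<lambda>_. borel) (\<lambda>x y. f x (y x)) A"
      by (intro prob_space.indep_vars_compose2[OF _ indep_vars_Pi_pmf])
         (auto simp: measure_pmf.prob_space_axioms \<open>finite A\<close>)
    show "integrable (measure_pmf (Pi_pmf A dflt p)) (\<lambda>y. f x (y x))" if "x \<in> A" for x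
      using that fin integrable_map_pmf_eq[of "\<lambda>y. y x" "Pi_pmf A dflt p" "f x"]
      by (simp add: comp integrable_measure_pmf_finite)
  qed (simp_all add: measure_pmf.prob_space_axioms \<open>finite A\<close>)
  also have "\<dots> = (\<Prod>x\<in>A. measure_pmf.expectation (p x) (f x))"
    by (intro prod.cong refl) (simp flip: comp)
  finally show ?thesis .
qed

lemma expectation_xor_coeffs_prod:
  fixes g :: "nat \<Rightarrow> bool \<Rightarrow> real"
  assumes "0 \<le> lam" "lam \<le> 1"
  shows "measure_pmf.expectation (xor_coeffs_pmf m lam) (\<lambda>a. \<Prod>i\<in>{0..m}. g i (a i)) =
     (g 0 True + g 0 False) / 2 * (\<Prod>i\<in>{1..m}. lam * g i True + (1 - lam) * g i False)"
proof -
  have "measure_pmf.expectation (xor_coeffs_pmf m lam) (\<lambda>a. \<Prod>i\<in>{0..m}. g i (a i)) =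
     (\<Prod>i\<in>{0..m}. measure_pmf.expectation
        (if i = 0 then bernoulli_pmf (1 / 2) else bernoulli_pmf lam) (g i))"
    unfolding xor_coeffs_pmf_def
    by (rule expectation_prod_Pi_pmf_finite_support) (auto intro: finite_subset)
  also have "\<dots> = (g 0 True + g 0 False) / 2 *
     (\<Prod>i\<in>{1..m}. lam * g i True + (1 - lam) * g i False)"
    using assms by (simp add: prod.atLeast_Suc_atMost field_simps)
  finally show ?thesis .
qed

lemma finite_set_xor_coeffs_pmf: "finite (set_pmf (xor_coeffs_pmf m lam))"
  unfolding xor_coeffs_pmf_def
  by (subst set_Pi_pmf) (auto intro!: finite_PiE_dflt)

text \<open>Multiplying the two indicators gives four terms. The fair constant makes
  \<open>P u\<close> and \<open>P v\<close> average to \<open>0\<close>. In their product the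
  constant and all agreeing positions cancel, and each disagreeing position contributes the mean
  \<open>1 - 2 * lam\<close>.\<close>

lemma expectation_holds_both:
  assumes "0 \<le> lam" "lam \<le> 1"
  shows "measure_pmf.expectation (map_pmf (xor_constraint m) (xor_coeffs_pmf m lam))
      (\<lambda>c. of_bool (holds u c \<and> holds v c)) = (1 + (1 - 2 * lam) ^ hamming_dist m u v) / 4"
    (is "?E = _")
proof -
  define P where "P w a = (\<Prod>i\<in>{0..m}. sign (a i \<and> (i = 0 \<or> w i)))" for w a
  define Q where "Q a = (\<Prod>i\<in>{0..m}. sign (a i \<and> i \<noteq> 0 \<and> u i \<noteq> v i))" for a
  have PQ: "P u a * P v a = Q a" for a
    unfolding P_def Q_def prod.distrib[symmetric] by (rule prod.cong) (auto simp: sign_def)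
  have "of_bool (holds u (xor_constraint m a) \<and> holds v (xor_constraint m a))
      = (1 + P u a + P v a + Q a) / 4" for a
    unfolding of_bool_conj of_bool_holds_xor_constraint P_def[symmetric] PQ[symmetric]
    by (simp add: field_simps)
  then have "?E = measure_pmf.expectation (xor_coeffs_pmf m lam) (\<lambda>a. (1 + P u a + P v a + Q a) / 4)"
    by (simp only: integral_map_pmf)
  also have "\<dots> = (1 + measure_pmf.expectation (xor_coeffs_pmf m lam) (P u)
      + measure_pmf.expectation (xor_coeffs_pmf m lam) (P v)
      + measure_pmf.expectation (xor_coeffs_pmf m lam) Q) / 4"
    by (simp add: integrable_measure_pmf_finite finite_set_xor_coeffs_pmf)
  finally have E: "?E = (1 + measure_pmf.expectation (xor_coeffs_pmf m lam) (P u)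
      + measure_pmf.expectation (xor_coeffs_pmf m lam) (P v)
      + measure_pmf.expectation (xor_coeffs_pmf m lam) Q) / 4" .
  have P0: "measure_pmf.expectation (xor_coeffs_pmf m lam) (P w) = 0" for w
    unfolding P_def
    using expectation_xor_coeffs_prod[OF assms, of m "\<lambda>i b. sign (b \<and> (i = 0 \<or> w i))"]
    by (simp add: sign_def)
  have "measure_pmf.expectation (xor_coeffs_pmf m lam) Q
      = (\<Prod>i\<in>{1..m}. if u i \<noteq> v i then 1 - 2 * lam else 1)"
    unfolding Q_def
    using expectation_xor_coeffs_prod[OF assms, of m "\<lambda>i b. sign (b \<and> i \<noteq> 0 \<and> u i \<noteq> v i)"]
    by (auto simp: sign_def intro!: prod.cong)
  also have "\<dots> = (1 - 2 * lam) ^ hamming_dist m u v"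
    by (simp add: prod.If_cases hamming_dist_def Int_def)
  finally show ?thesis using E P0 by simp
qed

lemma expectation_constraints_prod:
  fixes g :: "nat formula \<Rightarrow> real"
  shows "measure_pmf.expectation (constraints_pmf s m lam) (\<lambda>c. \<Prod>i\<in>{1..s}. g (c i))
    = measure_pmf.expectation (map_pmf (xor_constraint m) (xor_coeffs_pmf m lam)) g ^ s"
  unfolding constraints_pmf_def
  by (subst expectation_prod_Pi_pmf_finite_support) (auto simp: finite_set_xor_coeffs_pmf)

lemma finite_set_constraints_pmf: "finite (set_pmf (constraints_pmf s m lam))"
  unfolding constraints_pmf_def
  by (subst set_Pi_pmf) (auto intro!: finite_PiE_dflt simp: finite_set_xor_coeffs_pmf)

lemma holds_foldl_Conj: "holds v (foldl Conj p ps) \<longleftrightarrow> holds v p \<and> (\<forall>q\<in>set ps. holds v q)"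
  by (induction ps arbitrary: p) auto

lemma finite_models: "finite (models m p)"
  unfolding models_def by (rule finite_subset[of _ "{1..m} \<rightarrow>\<^sub>E UNIV"]) (auto intro: finite_PiE)

text \<open>A sum of products of indicators is the form to which linearity and
  \<open>expectation_constraints_prod\<close> apply.\<close>

lemma num_models_conj_constraints:
  "real (num_models m (conj_constraints s p c)) =
     (\<Sum>v\<in>models m p. \<Prod>i\<in>{1..s}. of_bool (holds v (c i)))"
proof -
  have eq: "models m (conj_constraints s p c) = {v \<in> models m p. \<forall>i\<in>{1..s}. holds v (c i)}"
    by (auto simp: models_def conj_constraints_def holds_foldl_Conj)
  have "(\<Prod>i\<in>{1..s}. of_bool (holds v (c i)) :: real) = of_bool (\<forall>i\<in>{1..s}. holds v (c i))" for v
    by (auto simp: prod_zero_iff intro!: prod.neutral)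
  then show ?thesis
    by (simp add: num_models_def eq finite_models sum.If_cases of_bool_def Int_def)
qed

lemma expectation_num_models:
  assumes "0 \<le> lam" "lam \<le> 1"
  shows "measure_pmf.expectation (constraints_pmf s m lam)
      (\<lambda>c. real (num_models m (conj_constraints s p c))) = real (num_models m p) / 2 ^ s"
proof -
  \<comment> \<open>Two equal assignments have distance \<open>0\<close>, and a zeroth power is
    \<open>1\<close> even when \<open>lam = 1 / 2\<close>.\<close>
  have half: "measure_pmf.expectation (map_pmf (xor_constraint m) (xor_coeffs_pmf m lam))
      (\<lambda>q. of_bool (holds v q)) = (1 / 2 :: real)" for v
    using expectation_holds_both[OF assms, of m v v]
    by (simp add: hamming_dist_def del: integral_map_pmf)
  have "measure_pmf.expectation (constraints_pmf s m lam)
      (\<lambda>c. \<Prod>i\<in>{1..s}. of_bool (holds v (c i))) = (1 / 2 :: real) ^ s" for v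
    unfolding expectation_constraints_prod[of s m lam "\<lambda>q. of_bool (holds v q)"] half ..
  then show ?thesis
    unfolding num_models_conj_constraints
    by (simp add: integrable_measure_pmf_finite finite_set_constraints_pmf num_models_def
        power_one_over)
qed

lemma expectation_num_models_square:
  assumes "0 \<le> lam" "lam \<le> 1"
  shows "measure_pmf.expectation (constraints_pmf s m lam)
      (\<lambda>c. (real (num_models m (conj_constraints s p c)))\<^sup>2) =
      (\<Sum>u\<in>models m p. \<Sum>v\<in>models m p. (1 + (1 - 2 * lam) ^ hamming_dist m u v) ^ s) / 4 ^ s"
proof -
  have "measure_pmf.expectation (constraints_pmf s m lam)
      (\<lambda>c. \<Prod>i\<in>{1..s}. of_bool (holds u (c i)) * of_bool (holds v (c i)))
      = (1 + (1 - 2 * lam) ^ hamming_dist m u v) ^ s / 4 ^ s" for u v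
    unfolding of_bool_conj[symmetric] expectation_holds_both[OF assms]
      expectation_constraints_prod[of s m lam "\<lambda>q. of_bool (holds u q \<and> holds v q)"]
    by (rule power_divide)
  then show ?thesis
    unfolding num_models_conj_constraints power2_eq_square sum_product prod.distrib[symmetric]
    by (simp add: integrable_measure_pmf_finite finite_set_constraints_pmf sum_divide_distrib)
qed

text \<open>The factor \<open>4 ^ s\<close> of the second moment cancels against the squared
  mean.\<close>

lemma relative_variance_num_models:
  fixes s m :: nat and p :: "nat formula" and lam :: real
  assumes "0 \<le> lam" "lam \<le> 1" and "num_models m p > 0"
  defines "T \<equiv> \<lambda>c. real (num_models m (conj_constraints s p c))"
  shows "measure_pmf.variance (constraints_pmf s m lam) T
      / (measure_pmf.expectation (constraints_pmf s m lam) T)\<^sup>2 =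
      (\<Sum>u\<in>models m p. \<Sum>v\<in>models m p. (1 + (1 - 2 * lam) ^ hamming_dist m u v) ^ s)
      / (real (num_models m p))\<^sup>2 - 1"
proof -
  have "measure_pmf.variance (constraints_pmf s m lam) T =
      measure_pmf.expectation (constraints_pmf s m lam) (\<lambda>c. (T c)\<^sup>2)
      - (measure_pmf.expectation (constraints_pmf s m lam) T)\<^sup>2"
    by (rule measure_pmf.variance_eq)
       (auto intro!: integrable_measure_pmf_finite finite_set_constraints_pmf)
  moreover have "(2 ^ s :: real)\<^sup>2 = 4 ^ s"
    by (simp add: power2_eq_square flip: power_mult_distrib)
  ultimately show ?thesis
    using assms(3) unfolding T_def expectation_num_models[OF assms(1,2)]
      expectation_num_models_square[OF assms(1,2)]
    by (simp add: power_divide diff_divide_distrib left_diff_distrib)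
qed

subsection \<open>Greedy filling of the distance classes\<close>

text \<open>The threshold \<open>w\<close> is arbitrary: by duality every choice gives a valid bound, and \<open>w\<^sup>*\<close> is
  merely the best one.\<close>

lemma average_le_greedy:
  fixes c b :: "nat \<Rightarrow> nat" and f :: "nat \<Rightarrow> real" and n N :: real
  assumes cb: "\<And>j. j \<in> {d..m} \<Longrightarrow> c j \<le> b j"
    and n: "real (\<Sum>j=d..m. c j) = n - 1" and "0 < N" "N \<le> n"
    and f: "antimono f"
  shows "(f 0 + (\<Sum>j=d..m. real (c j) * f j)) / n \<le>
    (f 0 + ((\<Sum>j=d..<w. real (b j) * f j) + (N - 1 - real (\<Sum>j=d..<w. b j)) * f w)) / N"
proof -
  \<comment> \<open>\<open>f w\<close> acts as the dual multiplier of the cardinality constraint;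
    \<open>G\<close> bounds the excess over this level that the capacities \<open>b j\<close>
    allow.\<close>
  define G where "G = (\<Sum>j=d..<w. real (b j) * (f j - f w))"
  have G0: "G \<ge> 0"
    unfolding G_def by (intro sum_nonneg mult_nonneg_nonneg) (auto intro: antimonoD[OF f])
  have f0: "f 0 \<ge> f w"
    by (rule antimonoD[OF f]) simp
  \<comment> \<open>Below \<open>w\<close> the weight is nonnegative and \<open>c j\<close> grows to
    \<open>b j\<close>; from \<open>w\<close> on it is nonpositive and the term is dropped.\<close>
  have "(\<Sum>j=d..m. real (c j) * (f j - f w)) \<le>
      (\<Sum>j=d..m. if j < w then real (b j) * (f j - f w) else 0)"
  proof (rule sum_mono)
    fix j assume "j \<in> {d..m}"
    then show "real (c j) * (f j - f w) \<le> (if j < w then real (b j) * (f j - f w) else 0)"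
      using cb[of j] antimonoD[OF f, of j w] antimonoD[OF f, of w j]
      by (auto intro!: mult_right_mono mult_nonneg_nonpos)
  qed
  also have "\<dots> = (\<Sum>j\<in>{d..m} \<inter> {j. j < w}. real (b j) * (f j - f w))"
    by (simp add: sum.If_cases)
  \<comment> \<open>The threshold may lie beyond \<open>m\<close>; the extra terms of
    \<open>G\<close> are nonnegative.\<close>
  also have "\<dots> \<le> G"
    unfolding G_def
    by (rule sum_mono2) (auto intro!: mult_nonneg_nonneg antimonoD[OF f])
  finally have "(\<Sum>j=d..m. real (c j) * (f j - f w)) \<le> G" .
  moreover have "(\<Sum>j=d..m. real (c j) * (f j - f w)) = (\<Sum>j=d..m. real (c j) * f j) - (n - 1) * f w"
    unfolding n[symmetric] by (simp add: right_diff_distrib sum_subtractf sum_distrib_right)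
  ultimately have "(f 0 + (\<Sum>j=d..m. real (c j) * f j)) / n \<le> (n * f w + (f 0 - f w + G)) / n"
    using assms(3,4) by (intro divide_right_mono) (auto simp: algebra_simps)
  also have "\<dots> = f w + (f 0 - f w + G) / n"
    using assms(3,4) by (simp add: add_divide_distrib)
  \<comment> \<open>The excess \<open>f 0 - f w + G\<close> is nonnegative and free of
    \<open>n\<close>, so a smaller denominator only enlarges the quotient.\<close>
  also have "\<dots> \<le> f w + (f 0 - f w + G) / N"
    using assms(3,4) f0 G0 by (intro add_left_mono divide_left_mono) auto
  also have "\<dots> = (N * f w + (f 0 - f w + G)) / N"
    using assms(3,4) by (simp add: add_divide_distrib)
  also have "N * f w + (f 0 - f w + G) =
      f 0 + ((\<Sum>j=d..<w. real (b j) * f j) + (N - 1 - real (\<Sum>j=d..<w. b j)) * f w)"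
    unfolding G_def by (simp add: right_diff_distrib left_diff_distrib sum_subtractf sum_distrib_right)
  finally show ?thesis .
qed

section \<open>Summation over all pairs of models and comparison with \<open>B\<close>\<close>

lemma hamming_dist_le: "hamming_dist m u v \<le> m"
  unfolding hamming_dist_def by (rule order_trans[OF card_mono[of "{1..m}"]]) auto

theorem theorem2:
  fixes m d s :: nat and \<phi> :: "nat formula" and \<beta> lam :: real and T :: "(nat \<Rightarrow> nat formula) \<Rightarrow> real"
  assumes "vars \<phi> \<subseteq> {1..m}"
    and "d \<ge> 1"
    and "\<And>u v. u \<in> models m \<phi> \<Longrightarrow> v \<in> models m \<phi> \<Longrightarrow> u \<noteq> v \<Longrightarrow> hamming_dist m u v \<ge> d"
    and "s \<ge> 1"
    and "\<beta> > 0"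
    and "0 < lam" and "lam \<le> 1 / 2"
    and "real (num_models m \<phi>) > 2 powr (real s + \<beta>)"
    and "T = (\<lambda>c. real (num_models m (conj_constraints s \<phi> c)))"
  shows "measure_pmf.variance (constraints_pmf s m lam) T
           / (measure_pmf.expectation (constraints_pmf s m lam) T)\<^sup>2 \<le> B s m \<beta> d lam"
proof -
  define M where "M = models m \<phi>"
  define n where "n = real (num_models m \<phi>)"
  define N where "N = real_of_int (N_bound s \<beta>)"
  define w where "w = w_star s m \<beta> d"
  define f where "f j = (1 + (1 - 2 * lam) ^ j) ^ s" for j
  \<comment> \<open>If no threshold qualifies, \<open>w\<close> is \<open>0\<close>, both sums are
    empty and \<open>R\<close> is \<open>(N - 1) * f 0\<close>; \<open>average_le_greedy\<close>
    covers this case too.\<close>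
  define R where "R = (\<Sum>j=d..<w. real (m choose l_idx m d j) * f j)
      + (N - 1 - real (\<Sum>j=d..<w. m choose l_idx m d j)) * f w"
  have finM: "finite M"
    by (simp add: M_def finite_models)
  have nM: "n = real (card M)"
    by (simp add: n_def M_def num_models_def)
  have pow: "2 powr (real s + \<beta>) \<le> N"
    unfolding N_def N_bound_def by (rule le_of_int_ceiling)
  then have N0: "N > 0"
    by (smt (verit) powr_gt_zero)
  \<comment> \<open>The number of models is an integer, so exceeding the power means reaching its
    ceiling.\<close>
  have "N_bound s \<beta> \<le> int (num_models m \<phi>)"
    unfolding N_bound_def using assms(8) by (simp add: ceiling_le_iff)
  then have Nn: "N \<le> n"
    unfolding N_def n_def by (metis of_int_le_iff of_int_of_nat_eq)
  \<comment> \<open>The range of \<open>lam\<close> puts \<open>1 - 2 * lam\<close> between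
    \<open>0\<close> and \<open>1\<close>.\<close>
  have anti: "antimono f"
    unfolding f_def using assms(6,7)
    by (intro antimonoI power_mono add_left_mono power_decreasing) auto
  have row: "(\<Sum>v\<in>M. f (hamming_dist m u v)) \<le> n * ((f 0 + R) / N)" if u: "u \<in> M" for u
  proof -
    define c where "c j = card {v \<in> M. hamming_dist m u v = j}" for j
    have img: "hamming_dist m u ` (M - {u}) \<subseteq> {d..m}"
      using assms(3)[of u] u hamming_dist_le by (fastforce simp: M_def)
    have cls: "{v \<in> M - {u}. hamming_dist m u v = j} = {v \<in> M. hamming_dist m u v = j}"
      if "j \<in> {d..m}" for j
      using that \<open>d \<ge> 1\<close> by (auto simp: hamming_dist_def)
    \<comment> \<open>Used with \<open>g = 1\<close> to count the models other than
      \<open>u\<close>, and with \<open>g = f\<close> for the row sum.\<close>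
    have group: "(\<Sum>v\<in>M - {u}. g (hamming_dist m u v)) = (\<Sum>j=d..m. real (c j) * g j)"
      for g :: "nat \<Rightarrow> real"
    proof -
      have "(\<Sum>v\<in>M - {u}. g (hamming_dist m u v)) =
          (\<Sum>j=d..m. \<Sum>v\<in>{v \<in> M - {u}. hamming_dist m u v = j}. g (hamming_dist m u v))"
        by (rule sum.group[OF _ _ img, symmetric]) (simp_all add: finM)
      also have "\<dots> = (\<Sum>j=d..m. real (c j) * g j)"
        by (intro sum.cong refl) (simp add: cls c_def del: Diff_iff)
      finally show ?thesis .
    qed
    have le: "c j \<le> m choose l_idx m d j" if "j \<in> {d..m}" for j
      unfolding c_def
      by (rule card_at_distance_le) (use assms(2,3) that in \<open>auto simp: M_def models_def\<close>)
    have "card M > 0"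
      using u finM card_gt_0_iff by blast
    then have "real (\<Sum>j=d..m. c j) = n - 1"
      using group[of "\<lambda>_. 1"] u finM by (simp add: nM of_nat_diff)
    then have "(f 0 + (\<Sum>j=d..m. real (c j) * f j)) / n \<le> (f 0 + R) / N"
      unfolding R_def by (intro average_le_greedy le N0 Nn anti)
    moreover have "(\<Sum>v\<in>M. f (hamming_dist m u v)) = f 0 + (\<Sum>j=d..m. real (c j) * f j)"
      using sum.remove[OF finM u, of "\<lambda>v. f (hamming_dist m u v)"] group[of f]
      by (simp add: hamming_dist_def)
    ultimately show ?thesis
      using N0 Nn by (simp add: pos_divide_le_eq mult.commute)
  qed
  have n0: "n > 0"
    using N0 Nn by simp
  have "(\<Sum>u\<in>M. \<Sum>v\<in>M. f (hamming_dist m u v)) \<le> n * (n * ((f 0 + R) / N))"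
    using sum_bounded_above[OF row] by (simp add: nM)
  then have avg: "(\<Sum>u\<in>M. \<Sum>v\<in>M. f (hamming_dist m u v)) / n\<^sup>2 \<le> (f 0 + R) / N"
    using n0 by (simp add: pos_divide_le_eq power2_eq_square mult_ac)
  obtain u where u: "u \<in> M"
    using n0 by (auto simp: nM card_gt_0_iff)
  \<comment> \<open>The sign of \<open>f 0 + R\<close> is read off from a row sum, without
    estimating the coefficient of \<open>f w\<close>. It permits replacing \<open>N\<close> by the
    smaller \<open>2 powr (real s + \<beta>)\<close>.\<close>
  have "0 \<le> n * ((f 0 + R) / N)"
    using row[OF u] by (rule order_trans[rotated])
       (use assms(6,7) in \<open>auto simp: f_def intro!: sum_nonneg\<close>)
  then have nonneg: "0 \<le> f 0 + R"
    using n0 N0 by (simp add: zero_le_mult_iff zero_le_divide_iff)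
  have "(f 0 + R) / N \<le> (f 0 + R) / 2 powr (real s + \<beta>)"
    using pow nonneg N0 by (intro divide_left_mono) auto
  \<comment> \<open>The diagonal value \<open>f 0 = 2 ^ s\<close> yields the leading term.\<close>
  also have "\<dots> = 2 powr (- \<beta>) + 2 powr (- real s - \<beta>) * R"
    by (simp add: f_def powr_minus_divide powr_diff powr_add powr_realpow add_divide_distrib)
  finally have "(f 0 + R) / N - 1 \<le> B s m \<beta> d lam"
    unfolding B_def Let_def R_def f_def N_def w_def N_star_def by simp
  moreover have "measure_pmf.variance (constraints_pmf s m lam) T
           / (measure_pmf.expectation (constraints_pmf s m lam) T)\<^sup>2
      = (\<Sum>u\<in>M. \<Sum>v\<in>M. f (hamming_dist m u v)) / n\<^sup>2 - 1"
    unfolding assms(9) f_def M_def n_def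
    by (rule relative_variance_num_models) (use assms(6,7) n0 in \<open>auto simp: n_def\<close>)
  ultimately show ?thesis
    using avg by simp
qed

end
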